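(* Let $X=(\mathbb{R}^3,\|\cdot\|)$ be a three-dimensional Banach space with unit ball $B_X$, let $m$ be a positive integer, and put $$\eta=\sup\{\beta_X(T,m) : T \text{ is a simplex in } \mathbb{R}^3\}.$$ Then $$\beta(X,m)\leq\inf_{\varepsilon\in(0,1/3)}\max\left\{\left(1+\frac{4\varepsilon}{1-3\varepsilon}\right)\eta,\ \frac{2(3-\varepsilon)}{4-\varepsilon}\,\beta_X(B_X,m)\right\}.$$
   Context: All spaces are real. For $X=(\mathbb{R}^n,\|\cdot\|)$ and a nonempty bounded set $A\subset\mathbb{R}^n$, $\delta(A)=\sup\{\|x-y\| : x,y\in A\}$ is the diameter of $A$ in $X$. Let $\mathcal{B}^n$ be the family of all bounded subsets of $\mathbb{R}^n$ with positive diameter. For a positive integer $m$ and $A\in\mathcal{B}^n$, $$\beta_X(A,m)=\inf\left\{\frac{1}{\delta(A)}\max_{1\leq k\leq m}\delta(A_k) : A=\bigcup_{k=1}^m A_k\right\},$$ where the empty set, if it occurs among the $A_k$, is given diameter $0$. Put $\beta(X,m)=\sup\{\beta_X(A,m) : A\in\mathcal{B}^n\}$. A simplex in $\mathbb{R}^3$ is a (nondegenerate) tetrahedron, i.e. the convex hull of four affinely independent points. *)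

theory Defs
  imports "HOL-Analysis.Analysis"
begin

text \<open>
  The normed space $X = (\mathbb{R}^n, \|\cdot\|)$ is given by an arbitrary norm \<open>N\<close> on
  \<open>real ^ 'n\<close>; the class operation \<open>norm\<close> is the Euclidean norm there, so the library constants
  \<open>diameter\<close> and \<open>cball\<close> cannot be used for \<open>X\<close>. The library predicate \<open>bounded\<close> can be, because all
  norms on \<open>real ^ 'n\<close> have the same bounded sets.
\<close>

definition is_norm :: "(real ^ 'n \<Rightarrow> real) \<Rightarrow> bool" where
  "is_norm N \<longleftrightarrow>
     (\<forall>x. 0 \<le> N x) \<and>
     (\<forall>x. N x = 0 \<longleftrightarrow> x = 0) \<and>
     (\<forall>c x. N (c *\<^sub>R x) = \<bar>c\<bar> * N x) \<and>
     (\<forall>x y. N (x + y) \<le> N x + N y)"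

definition unit_ball :: "(real ^ 'n \<Rightarrow> real) \<Rightarrow> (real ^ 'n) set" where
  "unit_ball N = {x. N x \<le> 1}"

definition diam :: "(real ^ 'n \<Rightarrow> real) \<Rightarrow> (real ^ 'n) set \<Rightarrow> real" where
  "diam N A = (if A = {} then 0 else SUP (x, y) \<in> A \<times> A. N (x - y))"

definition bounded_sets :: "(real ^ 'n \<Rightarrow> real) \<Rightarrow> (real ^ 'n) set set" where
  "bounded_sets N = {A. bounded A \<and> 0 < diam N A}"

text \<open>
  \<open>beta_set N A m\<close> is $\beta_X(A,m)$ and \<open>beta N m\<close> is $\beta(X,m)$. When \<open>N\<close> is
  a norm, \<open>A \<in> bounded_sets N\<close> and \<open>m \<ge> 1\<close>, the infimum is over a nonempty set of nonnegative
  reals, and the supremum is over a nonempty subset of \<open>[0, 1]\<close>.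
\<close>

definition beta_set :: "(real ^ 'n \<Rightarrow> real) \<Rightarrow> (real ^ 'n) set \<Rightarrow> nat \<Rightarrow> real" where
  "beta_set N A m =
     Inf {(1 / diam N A) * Max ((\<lambda>k. diam N (P k)) ` {1..m}) | P :: nat \<Rightarrow> (real ^ 'n) set.
            A = (\<Union>k\<in>{1..m}. P k)}"

definition beta :: "(real ^ 'n \<Rightarrow> real) \<Rightarrow> nat \<Rightarrow> real" where
  "beta N m = (SUP A \<in> bounded_sets N. beta_set N A m)"

end

theory Submission imports Defs begin

text \<open>
  Replacing a bounded set by its closed convex hull \<open>K\<close> keeps the diameter \<open>\<delta>\<close>, and a partition
  of a set \<open>T\<close> induces a partition of every set inside a dilate of \<open>T\<close>. Hence it suffices to trap \<open>K\<close>
  either in a small dilate of the unit ball or in a slightly enlarged copy of a simplex whose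
  diameter is at most \<open>\<delta>\<close>. Which of the two happens depends on how asymmetric \<open>K\<close> is.

  Write \<open>n\<close> for the dimension and \<open>s = n - \<epsilon>\<close>. Suppose that some point \<open>c\<close> has the property
  that the reflection of \<open>K\<close> in \<open>c\<close>, shrunk by the factor \<open>1/s\<close>, lies in \<open>K\<close>. Each \<open>x \<in> K\<close> then
  has a partner \<open>k \<in> K\<close> on the other side of \<open>c\<close> with \<open>x - c = (s/(s+1)) (x - k)\<close>, so \<open>K\<close> lies
  in the ball around \<open>c\<close> of radius \<open>(s/(s+1)) \<delta>\<close> (\<open>reflection_centre_imp_subset_ball\<close>). As the unit
  ball has diameter \<open>2\<close>, this gives the second term of the maximum.

  Suppose that no such \<open>c\<close> exists. The points that serve a single \<open>x \<in> K\<close> form the compact convex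
  set \<open>(x + s K)/(s+1)\<close>, so by Helly's theorem there are \<open>n + 1\<close> points of \<open>K\<close> that admit no common
  \<open>c\<close>. These points are the vertices of the wanted simplex. The decisive lemma is
  \<open>common_reflection_centre\<close>: if the points were affinely dependent, or if some \<open>y \<in> K\<close> had
  a barycentric coordinate at most \<open>- \<epsilon>/(1 - n \<epsilon>)\<close> with respect to them, then an explicit
  perturbation of their centroid would be a common \<open>c\<close>. So all coordinates of all points of \<open>K\<close>
  exceed \<open>- \<epsilon>/(1 - n \<epsilon>)\<close>, and this says that \<open>K\<close> lies in the simplex dilated about its centroid
  by the factor \<open>1 + (n + 1) \<epsilon>/(1 - n \<epsilon>)\<close>. This gives the first term of the maximum.
\<close>

section \<open>Helly's theorem for compact indexed families\<close>

text \<open>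
  Helly's theorem for a finite family of sets needs at least \<open>DIM('a) + 1\<close> distinct members, but
  different indices may carry the same set. A subfamily with fewer distinct members is represented by
  exactly \<open>DIM('a) + 1\<close> indices; if the subfamily itself has too few, the infinite index set
  supplies the rest.
\<close>

lemma Helly_compact_indexed:
  fixes F :: "'i \<Rightarrow> 'a::euclidean_space set"
  assumes "infinite I"
    and compact: "\<And>i. i \<in> I \<Longrightarrow> compact (F i)"
    and convex: "\<And>i. i \<in> I \<Longrightarrow> convex (F i)"
    and meet: "\<And>S. S \<subseteq> I \<Longrightarrow> card S = DIM('a) + 1 \<Longrightarrow> (\<Inter>i\<in>S. F i) \<noteq> {}"
  shows "(\<Inter>i\<in>I. F i) \<noteq> {}"
proof -
  have finite_meet: "(\<Inter>i\<in>J. F i) \<noteq> {}" if J: "finite J" "J \<subseteq> I" for J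
  proof (cases "card J \<le> DIM('a) + 1")
    case True
    obtain B where "finite B" "card B = DIM('a) + 1 + card J" "B \<subseteq> I"
      using infinite_arbitrarily_large[OF \<open>infinite I\<close>] by blast
    then have "DIM('a) + 1 \<le> card (J \<union> B)" "finite (J \<union> B)"
      using J card_mono[of "J \<union> B" B] by auto
    then obtain S where "J \<subseteq> S" "S \<subseteq> J \<union> B" "card S = DIM('a) + 1"
      using exists_subset_between[of J "DIM('a) + 1" "J \<union> B"] True by auto
    moreover from this have "S \<subseteq> I" using J \<open>B \<subseteq> I\<close> by auto
    ultimately show ?thesis using meet[of S] by blast
  next
    case large: False
    show ?thesis
    proof (cases "card (F ` J) \<le> DIM('a) + 1")
      case True
      obtain J' where J': "J' \<subseteq> J" "inj_on F J'" "F ` J = F ` J'"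
        using subset_image_inj[of "F ` J" F J] by auto
      then have "card J' \<le> DIM('a) + 1"
        using True by (simp add: card_image)
      then obtain S where "J' \<subseteq> S" "S \<subseteq> J" "card S = DIM('a) + 1"
        using exists_subset_between[of J' "DIM('a) + 1" J] large J J' by auto
      moreover from this have "F ` S = F ` J" using J' by (metis image_mono subset_antisym)
      ultimately show ?thesis using meet[of S] J by (metis order_trans)
    next
      case False
      show ?thesis
      proof (rule Helly)
        show "DIM('a) + 1 \<le> card (F ` J)" using False by simp
        show "\<forall>s\<in>F ` J. convex s" using convex J by auto
        fix t assume t: "t \<subseteq> F ` J" "card t = DIM('a) + 1"
        then obtain S where "S \<subseteq> J" "inj_on F S" "t = F ` S"
          by (meson subset_image_inj)
        then show "\<Inter>t \<noteq> {}" using meet[of S] t J by (simp add: card_image subset_trans)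
      qed
    qed
  qed
  obtain i where i: "i \<in> I" using \<open>infinite I\<close> by fastforce
  have "F i \<inter> (\<Inter>j\<in>I. F j) \<noteq> {}"
  proof (rule compact_imp_fip_image)
    show "compact (F i)" using compact i .
    show "closed (F j)" if "j \<in> I" for j using compact that compact_imp_closed by blast
    show "F i \<inter> (\<Inter>j\<in>J. F j) \<noteq> {}" if "finite J" "J \<subseteq> I" for J
      using finite_meet[of "insert i J"] that i by auto
  qed
  then show ?thesis by blast
qed

section \<open>Points that reflect a convex body into itself\<close>

text \<open>
  The points \<open>c\<close> for which the point \<open>k\<close> opposite to \<open>x\<close>, with \<open>c - k = (x - c)/s\<close>, lies
  in \<open>K\<close>. The least \<open>s\<close> for which all \<open>x \<in> K\<close> share such a point is the Minkowski measure of
  asymmetry of a convex body \<open>K\<close>.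
\<close>

definition reflection_centres :: "real \<Rightarrow> 'a::real_vector set \<Rightarrow> 'a \<Rightarrow> 'a set" where
  "reflection_centres s K x = {c. \<exists>k\<in>K. (s + 1) *\<^sub>R c = s *\<^sub>R k + x}"

lemma reflection_centres_affine_image:
  assumes "0 < s"
  shows "reflection_centres s K x
    = (\<lambda>k. (1 / (s + 1)) *\<^sub>R x + (s / (s + 1)) *\<^sub>R k) ` K"
proof -
  have "(s + 1) *\<^sub>R c = s *\<^sub>R k + x \<longleftrightarrow> c = (1 / (s + 1)) *\<^sub>R x + (s / (s + 1)) *\<^sub>R k"
    for c k :: 'a
  proof
    assume eq: "(s + 1) *\<^sub>R c = s *\<^sub>R k + x"
    have "c = (1 / (s + 1)) *\<^sub>R ((s + 1) *\<^sub>R c)" using assms by simp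
    then show "c = (1 / (s + 1)) *\<^sub>R x + (s / (s + 1)) *\<^sub>R k"
      unfolding eq by (simp add: scaleR_add_right)
  qed (use assms in \<open>simp add: scaleR_add_right\<close>)
  then show ?thesis unfolding reflection_centres_def by auto
qed

text \<open>
  Weights with an arbitrary sum are more convenient than convex combinations here, since the
  weights met below add up to \<open>s\<close>, and partial sums may vanish.
\<close>

lemma convex_weighted_sum:
  fixes K :: "'a::real_vector set"
  assumes "convex K" "K \<noteq> {}" "finite I" "\<And>i. i \<in> I \<Longrightarrow> 0 \<le> w i" "\<And>i. i \<in> I \<Longrightarrow> f i \<in> K"
  shows "\<exists>k\<in>K. (\<Sum>i\<in>I. w i *\<^sub>R f i) = sum w I *\<^sub>R k"
proof (cases "sum w I = 0")
  case True
  then have "\<And>i. i \<in> I \<Longrightarrow> w i = 0" using assms by (simp add: sum_nonneg_eq_0_iff)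
  then show ?thesis using True assms(2) by auto
next
  case False
  have "(\<Sum>i\<in>I. (w i / sum w I) *\<^sub>R f i) \<in> K"
    using assms False
    by (intro convex_sum) (auto simp: sum_nonneg simp flip: sum_divide_distrib)
  moreover have "sum w I *\<^sub>R (\<Sum>i\<in>I. (w i / sum w I) *\<^sub>R f i) = (\<Sum>i\<in>I. w i *\<^sub>R f i)"
    using False by (simp add: scaleR_sum_right)
  ultimately show ?thesis by metis
qed

lemma convex_weighted_pair:
  fixes K :: "'a::real_vector set"
  assumes "convex K" "x \<in> K" "y \<in> K" "0 \<le> \<alpha>" "0 \<le> \<beta>"
  shows "\<exists>k\<in>K. \<alpha> *\<^sub>R x + \<beta> *\<^sub>R y = (\<alpha> + \<beta>) *\<^sub>R k"
  using convex_weighted_sum[of K "UNIV :: bool set" "\<lambda>b. if b then \<alpha> else \<beta>" "\<lambda>b. if b then x else y"] assms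
  by (force simp: UNIV_bool add.commute)

text \<open>
  The centre is \<open>c = z/(s + 1)\<close> with \<open>z\<close> the sum of \<open>S\<close> less \<open>\<epsilon> p\<close>, so that \<open>z - x\<close> has to lie
  in \<open>s K\<close> for each \<open>x \<in> S\<close>. For \<open>x \<noteq> p\<close> the coefficients of \<open>z - x\<close> are nonnegative with sum \<open>s\<close>.
  For \<open>x = p\<close> the coefficient of \<open>p\<close> is \<open>- \<epsilon>\<close>; adding \<open>\<epsilon>/t\<close> times the relation
  between \<open>u y\<close> and the points of \<open>S\<close> removes it, and the other coefficients \<open>1 - \<epsilon> a v/t\<close> stay
  nonnegative because \<open>a v \<le> u + n t\<close>.

  The factor \<open>u\<close> covers two situations at once: \<open>u = 1\<close> when \<open>a\<close> gives affine coordinates of \<open>y\<close>,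
  and \<open>u = 0\<close> when \<open>a\<close> is an affine dependence of \<open>S\<close>.
\<close>

lemma common_reflection_centre:
  fixes K :: "'a::real_vector set" and n :: nat
  assumes K: "convex K" "S \<subseteq> K" "y \<in> K"
    and S: "finite S" "card S = n + 1"
    and \<epsilon>: "0 < \<epsilon>" "\<epsilon> \<le> 1" "\<epsilon> < real n"
    and p: "p \<in> S" "0 < t" "a p = - t" "\<And>v. v \<in> S \<Longrightarrow> - t \<le> a v"
    and y: "(\<Sum>v\<in>S. a v *\<^sub>R v) = u *\<^sub>R y" "sum a S = u" "0 \<le> u"
    and small: "\<epsilon> * (u + real n * t) \<le> t"
  shows "\<exists>c. \<forall>x\<in>S. c \<in> reflection_centres (real n - \<epsilon>) K x"
proof -
  define s where "s = real n - \<epsilon>"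
  have s: "0 < s" using \<epsilon> by (simp add: s_def)
  have ne: "K \<noteq> {}" using K by auto
  define z where "z = (\<Sum>v\<in>S. v) - \<epsilon> *\<^sub>R p"
  \<comment> \<open>All other coordinates are at least \<open>- t\<close> and the total is \<open>u\<close>, so none can be too large.\<close>
  have coord_le: "\<epsilon> * a v \<le> t" if v: "v \<in> S" for v
  proof -
    have "(\<Sum>w\<in>S - {v}. - t) \<le> sum a (S - {v})"
      by (rule sum_mono) (use p in auto)
    moreover have "sum a S = a v + sum a (S - {v})"
      using S v by (simp add: sum.remove)
    ultimately have "a v \<le> u + real n * t"
      using S v y(2) by simp
    then have "\<epsilon> * a v \<le> \<epsilon> * (u + real n * t)" using \<epsilon> by (simp add: mult_left_mono)
    then show ?thesis using small by linarith
  qed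
  have "\<exists>k\<in>K. z = s *\<^sub>R k + x" if x: "x \<in> S" for x
  proof (cases "x = p")
    case False
    define w where "w = (\<lambda>v. if v = p then 1 - \<epsilon> else 1)"
    have px: "p \<in> S - {x}" using p False by auto
    have "sum w (S - {x}) = w p + sum w (S - {x} - {p})"
      using S px by (simp add: sum.remove)
    also have "sum w (S - {x} - {p}) = real n - 1"
    proof -
      have "card (S - {x} - {p}) = n - 1" using S px x by (simp add: card_Diff_singleton)
      moreover have "n \<ge> 1" using S px x card_gt_0_iff[of "S - {x}"] by fastforce
      ultimately show ?thesis by (simp add: w_def of_nat_diff)
    qed
    finally have sum_w: "sum w (S - {x}) = s" by (simp add: w_def s_def)
    have "(\<Sum>v\<in>S - {x}. w v *\<^sub>R v) = w p *\<^sub>R p + (\<Sum>v\<in>S - {x} - {p}. w v *\<^sub>R v)"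
      using S px by (simp add: sum.remove)
    also have "(\<Sum>v\<in>S - {x} - {p}. w v *\<^sub>R v) = (\<Sum>v\<in>S - {x} - {p}. v)"
      by (rule sum.cong) (auto simp: w_def)
    also have "w p *\<^sub>R p + (\<Sum>v\<in>S - {x} - {p}. v) = (\<Sum>v\<in>S - {x}. v) - \<epsilon> *\<^sub>R p"
      using S px by (simp add: w_def sum.remove[of "S - {x}" p] algebra_simps)
    also have "\<dots> = z - x"
      using S x by (simp add: z_def sum.remove[of S x])
    finally have "z = (\<Sum>v\<in>S - {x}. w v *\<^sub>R v) + x" by simp
    moreover have "\<exists>k\<in>K. (\<Sum>v\<in>S - {x}. w v *\<^sub>R v) = sum w (S - {x}) *\<^sub>R k"
      by (rule convex_weighted_sum) (use K S ne \<epsilon> in \<open>auto simp: w_def\<close>)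
    ultimately show ?thesis using sum_w by auto
  next
    case True
    define w where "w v = 1 - \<epsilon> / t * a v" for v
    have w_nonneg: "0 \<le> w v" if "v \<in> S" for v
      using coord_le[OF that] p(2) by (simp add: w_def field_simps)
    have sum_w: "sum w (S - {p}) = s - \<epsilon> / t * u"
    proof -
      have "sum a (S - {p}) = u + t" using S p y by (simp add: sum_diff1)
      moreover have "sum w (S - {p}) = real n - \<epsilon> / t * sum a (S - {p})"
        using S p by (simp add: w_def sum_subtractf sum_distrib_left)
      ultimately show ?thesis using p(2) by (simp add: s_def field_simps)
    qed
    have "(\<Sum>v\<in>S - {p}. a v *\<^sub>R v) = u *\<^sub>R y + t *\<^sub>R p"
      using S p y(1) by (simp add: sum_diff1)
    moreover have "(\<Sum>v\<in>S - {p}. w v *\<^sub>R v)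
      = (\<Sum>v\<in>S - {p}. v) - (\<epsilon> / t) *\<^sub>R (\<Sum>v\<in>S - {p}. a v *\<^sub>R v)"
      by (simp add: w_def scaleR_diff_left sum_subtractf scaleR_sum_right)
    ultimately have z_eq: "z = ((\<epsilon> / t * u) *\<^sub>R y + (\<Sum>v\<in>S - {p}. w v *\<^sub>R v)) + p"
      using S p by (simp add: z_def sum.remove[of S p] scaleR_add_right)
    obtain k where k: "k \<in> K" "(\<Sum>v\<in>S - {p}. w v *\<^sub>R v) = (s - \<epsilon> / t * u) *\<^sub>R k"
      using convex_weighted_sum[of K "S - {p}" w "\<lambda>v. v"] K S ne w_nonneg sum_w by auto
    have "0 \<le> s - \<epsilon> / t * u"
      unfolding sum_w[symmetric] by (rule sum_nonneg) (use w_nonneg in auto)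
    moreover have "0 \<le> \<epsilon> / t * u" using \<epsilon> p y by simp
    ultimately obtain k' where "k' \<in> K"
      "(\<epsilon> / t * u) *\<^sub>R y + (s - \<epsilon> / t * u) *\<^sub>R k = (\<epsilon> / t * u + (s - \<epsilon> / t * u)) *\<^sub>R k'"
      using convex_weighted_pair[OF K(1) K(3) k(1)] by blast
    then show ?thesis using z_eq k True by auto
  qed
  then have "\<forall>x\<in>S. (1 / (s + 1)) *\<^sub>R z \<in> reflection_centres s K x"
    using s by (auto simp: reflection_centres_def)
  then show ?thesis unfolding s_def by blast
qed

section \<open>Asymmetric bodies are close to simplices\<close>

text \<open>
  An affine dependence has a most negative coefficient \<open>- t\<close>; it plays the role of a point \<open>y\<close> at
  infinity, and the smallness condition becomes \<open>\<epsilon> n \<le> 1\<close>.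
\<close>

lemma asymmetric_imp_affine_independent:
  fixes K :: "'a::real_vector set" and n :: nat
  assumes K: "convex K" "S \<subseteq> K"
    and S: "finite S" "card S = n + 1"
    and \<epsilon>: "0 < \<epsilon>" "\<epsilon> * real n \<le> 1" "1 \<le> n" "\<epsilon> < real n"
    and no_centre: "\<nexists>c. \<forall>x\<in>S. c \<in> reflection_centres (real n - \<epsilon>) K x"
  shows "\<not> affine_dependent S"
proof
  assume "affine_dependent S"
  then obtain a v where a: "sum a S = 0" "v \<in> S" "a v \<noteq> 0" "(\<Sum>v\<in>S. a v *\<^sub>R v) = 0"
    using S affine_dependent_explicit_finite by blast
  obtain p where p: "p \<in> S" "\<And>v. v \<in> S \<Longrightarrow> a p \<le> a v"
    using S a(2) arg_min_if_finite[of S a] by (metis empty_iff linorder_not_less)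
  have "a p < 0"
  proof (rule ccontr)
    assume "\<not> a p < 0"
    then have "\<And>v. v \<in> S \<Longrightarrow> 0 \<le> a v" using p(2) by fastforce
    then show False using a S sum_nonneg_eq_0_iff by blast
  qed
  have "\<epsilon> * 1 \<le> \<epsilon> * real n" using \<epsilon> by (intro mult_left_mono) auto
  then have "\<epsilon> \<le> 1" using \<epsilon>(2) by linarith
  have "\<exists>c. \<forall>x\<in>S. c \<in> reflection_centres (real n - \<epsilon>) K x"
  proof (rule common_reflection_centre[where a = a and t = "- a p" and u = 0])
    show "\<epsilon> * (0 + real n * - a p) \<le> - a p"
      using mult_right_mono[of "\<epsilon> * real n" 1 "- a p"] \<epsilon> \<open>a p < 0\<close> by (simp add: mult.assoc)
    show "p \<in> K" using p K by auto
  qed (use assms p a \<open>a p < 0\<close> \<open>\<epsilon> \<le> 1\<close> in auto)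
  then show False using no_centre by blast
qed

text \<open>
  If the least coordinate is \<open>- t\<close>, the smallness condition of \<open>common_reflection_centre\<close> reads
  \<open>\<epsilon> (1 + n t) \<le> t\<close>, that is \<open>t \<ge> \<epsilon>/(1 - n \<epsilon>)\<close>.
\<close>

lemma asymmetric_imp_coordinates_bounded:
  fixes K :: "'a::real_vector set" and n :: nat
  assumes K: "convex K" "S \<subseteq> K" "y \<in> K"
    and S: "finite S" "card S = n + 1"
    and \<epsilon>: "0 < \<epsilon>" "\<epsilon> * real n < 1" "1 \<le> n"
    and no_centre: "\<nexists>c. \<forall>x\<in>S. c \<in> reflection_centres (real n - \<epsilon>) K x"
    and a: "sum a S = 1" "(\<Sum>v\<in>S. a v *\<^sub>R v) = y" "v \<in> S"
  shows "- \<epsilon> / (1 - real n * \<epsilon>) < a v"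
proof (rule ccontr)
  assume neg: "\<not> - \<epsilon> / (1 - real n * \<epsilon>) < a v"
  obtain p where p: "p \<in> S" "\<And>v. v \<in> S \<Longrightarrow> a p \<le> a v"
    using S a(3) arg_min_if_finite[of S a] by (metis empty_iff linorder_not_less)
  have "\<epsilon> * 1 \<le> \<epsilon> * real n" using \<epsilon> by (intro mult_left_mono) auto
  then have \<epsilon>1: "\<epsilon> < 1" using \<epsilon>(2) by linarith
  have pos: "0 < 1 - real n * \<epsilon>" using \<epsilon> by (simp add: mult.commute)
  have "a p \<le> - \<epsilon> / (1 - real n * \<epsilon>)" using neg p(2)[OF a(3)] by simp
  then have t: "\<epsilon> \<le> - a p * (1 - real n * \<epsilon>)"
    using pos by (simp add: field_simps)
  then have "0 < - a p * (1 - real n * \<epsilon>)" using \<epsilon>(1) by linarith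
  then have "0 < - a p" using pos by (rule zero_less_mult_pos2)
  have "\<exists>c. \<forall>x\<in>S. c \<in> reflection_centres (real n - \<epsilon>) K x"
  proof (rule common_reflection_centre[where a = a and t = "- a p" and u = 1])
    show "\<epsilon> * (1 + real n * - a p) \<le> - a p" using t by (simp add: algebra_simps)
    have "1 \<le> real n" using \<epsilon>(3) by simp
    then show "\<epsilon> < real n" using \<epsilon>1 by linarith
  qed (use assms p a \<open>0 < - a p\<close> \<epsilon>1 in auto)
  then show False using no_centre by blast
qed

text \<open>
  Dilation by \<open>r\<close> about the centroid of a simplex replaces each barycentric coordinate \<open>b\<close>
  by \<open>r b + (1 - r)/(n + 1)\<close>; the weights \<open>b\<close> of the preimage of \<open>y\<close> undo this.
\<close>

lemma coordinates_bounded_imp_in_dilation: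
  fixes S :: "'a::real_vector set" and n :: nat
  assumes S: "finite S" "card S = n + 1"
    and a: "sum a S = 1" "(\<Sum>v\<in>S. a v *\<^sub>R v) = y"
    and r: "0 < r" "\<And>v. v \<in> S \<Longrightarrow> (1 - r) / (real n + 1) \<le> a v"
  shows "y \<in> (\<lambda>x. ((1 - r) / (real n + 1)) *\<^sub>R (\<Sum>v\<in>S. v) + r *\<^sub>R x) ` (convex hull S)"
proof -
  define h where "h = (1 - r) / (real n + 1)"
  define b where "b v = (a v - h) / r" for v
  define x where "x = (\<Sum>v\<in>S. b v *\<^sub>R v)"
  have h: "(real n + 1) * h = 1 - r" by (simp add: h_def)
  have "sum b S = (1 - (real n + 1) * h) / r"
    using S a by (simp add: b_def sum_subtractf add.commute flip: sum_divide_distrib)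
  then have "sum b S = 1" using r(1) h by simp
  moreover have "\<forall>v\<in>S. 0 \<le> b v" using r by (simp add: b_def h_def)
  ultimately have "x \<in> convex hull S"
    unfolding convex_hull_finite[OF S(1)] x_def by auto
  moreover have "r *\<^sub>R x = y - h *\<^sub>R (\<Sum>v\<in>S. v)"
    using r(1) unfolding x_def b_def a(2)[symmetric]
    by (simp add: scaleR_sum_right scaleR_diff_left sum_subtractf)
  ultimately show ?thesis unfolding h_def by (auto intro!: image_eqI[of _ _ x])
qed

text \<open>
  A stability theorem for the Minkowski measure of asymmetry. Its largest possible value
  is \<open>n\<close>, attained by simplices only; a body whose asymmetry exceeds \<open>n - \<epsilon>\<close> is close to a simplex.
\<close>

theorem symmetric_or_close_to_simplex:
  fixes K :: "'a::euclidean_space set" and n :: nat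
  assumes n: "DIM('a) = n"
    and K: "compact K" "convex K" "infinite K"
    and \<epsilon>: "0 < \<epsilon>" "\<epsilon> < 1 / real n"
  obtains (symmetric) c where "\<And>x. x \<in> K \<Longrightarrow> c \<in> reflection_centres (real n - \<epsilon>) K x"
  | (simplex) S g where "int n simplex convex hull S" "S \<subseteq> K"
      "K \<subseteq> (\<lambda>x. g + (1 + (real n + 1) * \<epsilon> / (1 - real n * \<epsilon>)) *\<^sub>R x) ` (convex hull S)"
proof (cases "(\<Inter>x\<in>K. reflection_centres (real n - \<epsilon>) K x) = {}")
  case False
  then show ?thesis using symmetric by blast
next
  case True
  have n1: "1 \<le> n" using n DIM_positive[where 'a = 'a] by simp
  have \<epsilon>n: "\<epsilon> * real n < 1" using \<epsilon> n1 by (simp add: field_simps)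
  have "\<epsilon> * 1 \<le> \<epsilon> * real n" using \<epsilon> n1 by (intro mult_left_mono) auto
  moreover have "1 \<le> real n" using n1 by simp
  ultimately have s: "\<epsilon> < real n" using \<epsilon>n by linarith
  have "\<exists>S\<subseteq>K. card S = n + 1 \<and> (\<Inter>x\<in>S. reflection_centres (real n - \<epsilon>) K x) = {}"
  proof (rule ccontr)
    assume "\<not> ?thesis"
    then have meet: "(\<Inter>x\<in>S. reflection_centres (real n - \<epsilon>) K x) \<noteq> {}"
      if "S \<subseteq> K" "card S = DIM('a) + 1" for S
      using that n by blast
    have "compact (reflection_centres (real n - \<epsilon>) K x)"
      "convex (reflection_centres (real n - \<epsilon>) K x)" for x
      using reflection_centres_affine_image[of "real n - \<epsilon>" K x] s K
      by (simp_all add: compact_affinity convex_affinity)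
    then have "(\<Inter>x\<in>K. reflection_centres (real n - \<epsilon>) K x) \<noteq> {}"
      using Helly_compact_indexed[OF K(3) _ _ meet] by blast
    then show False using True by blast
  qed
  then obtain S where S: "S \<subseteq> K" "card S = n + 1"
    and no_centre: "\<nexists>c. \<forall>x\<in>S. c \<in> reflection_centres (real n - \<epsilon>) K x"
    by blast
  have fin: "finite S" using S(2) card.infinite by fastforce
  have indep: "\<not> affine_dependent S"
    using asymmetric_imp_affine_independent[OF K(2) S(1) fin S(2) \<epsilon>(1) _ n1 s no_centre] \<epsilon>n by simp
  define r where "r = 1 + (real n + 1) * \<epsilon> / (1 - real n * \<epsilon>)"
  have pos: "0 < 1 - real n * \<epsilon>" using \<epsilon>n by (simp add: mult.commute)
  have r: "0 < r" unfolding r_def using pos \<epsilon> by (intro add_pos_nonneg) auto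
  have h: "(1 - r) / (real n + 1) = - \<epsilon> / (1 - real n * \<epsilon>)"
    using pos by (simp add: r_def)
  have "y \<in> (\<lambda>x. ((1 - r) / (real n + 1)) *\<^sub>R (\<Sum>v\<in>S. v) + r *\<^sub>R x) ` (convex hull S)"
    if y: "y \<in> K" for y
  proof -
    have "y \<in> affine hull S"
      using affine_independent_span_eq[OF indep] S(2) n by simp
    then obtain a where a: "sum a S = 1" "(\<Sum>v\<in>S. a v *\<^sub>R v) = y"
      unfolding affine_hull_finite[OF fin] by blast
    then have "- \<epsilon> / (1 - real n * \<epsilon>) \<le> a v" if "v \<in> S" for v
      using asymmetric_imp_coordinates_bounded[OF K(2) S(1) y fin S(2) \<epsilon>(1) \<epsilon>n n1 no_centre] that
      by (simp add: less_imp_le)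
    then show ?thesis
      using coordinates_bounded_imp_in_dilation[OF fin S(2) a r] h by simp
  qed
  moreover have "int n simplex convex hull S"
    unfolding simplex_def using indep S(2) by (intro exI[of _ S]) auto
  ultimately show ?thesis using simplex S(1) unfolding r_def by blast
qed

section \<open>Diameters and partitions in the given norm\<close>

lemma norm_commute:
  assumes "is_norm N"
  shows "N (x - y) = N (y - x)"
proof -
  have "N ((- 1) *\<^sub>R (y - x)) = \<bar>- 1\<bar> * N (y - x)"
    using assms unfolding is_norm_def by blast
  then show ?thesis by simp
qed

lemma is_norm_convex_on:
  assumes "is_norm N"
  shows "convex_on UNIV N"
proof (rule convex_onI)
  fix t x y assume t: "0 < (t::real)" "t < 1"
  have "N ((1 - t) *\<^sub>R x + t *\<^sub>R y) \<le> N ((1 - t) *\<^sub>R x) + N (t *\<^sub>R y)"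
    using assms unfolding is_norm_def by blast
  also have "\<dots> = (1 - t) * N x + t * N y"
    using assms t by (simp add: is_norm_def)
  finally show "N ((1 - t) *\<^sub>R x + t *\<^sub>R y) \<le> (1 - t) * N x + t * N y" .
qed simp

lemma is_norm_continuous_on: "is_norm N \<Longrightarrow> continuous_on S N"
  using convex_on_continuous[OF open_UNIV is_norm_convex_on] continuous_on_subset by blast

lemma convex_norm_ball:
  assumes "is_norm N"
  shows "convex {y. N (x - y) \<le> d}"
proof (rule convexI)
  fix y z :: "real ^ 'a" and u v :: real
  assume yz: "y \<in> {y. N (x - y) \<le> d}" "z \<in> {y. N (x - y) \<le> d}"
    and uv: "0 \<le> u" "0 \<le> v" "u + v = 1"
  have "x - (u *\<^sub>R y + v *\<^sub>R z) = (u + v) *\<^sub>R x - (u *\<^sub>R y + v *\<^sub>R z)"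
    using uv by simp
  also have "\<dots> = u *\<^sub>R (x - y) + v *\<^sub>R (x - z)" by (simp add: algebra_simps)
  finally have "N (x - (u *\<^sub>R y + v *\<^sub>R z)) \<le> N (u *\<^sub>R (x - y)) + N (v *\<^sub>R (x - z))"
    using assms unfolding is_norm_def by metis
  also have "\<dots> = u * N (x - y) + v * N (x - z)"
    using assms uv by (simp add: is_norm_def)
  also have "\<dots> \<le> d" using yz uv by (intro convex_bound_le) auto
  finally show "u *\<^sub>R y + v *\<^sub>R z \<in> {y. N (x - y) \<le> d}" by simp
qed

lemma closed_norm_ball:
  assumes "is_norm N"
  shows "closed {y. N (x - y) \<le> d}"
  by (intro closed_Collect_le continuous_intros
      continuous_on_compose2[OF is_norm_continuous_on[OF assms, of UNIV]]) auto

lemma bounded_unit_ball: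
  assumes N: "is_norm N"
  shows "bounded (unit_ball N)"
proof -
  have "compact (sphere (0 :: real ^ 'n) 1)" "sphere (0 :: real ^ 'n) 1 \<noteq> {}" by auto
  then obtain w where w: "norm w = 1" "\<And>x. norm x = 1 \<Longrightarrow> N w \<le> N x"
    using continuous_attains_inf[OF _ _ is_norm_continuous_on[OF N]] by (metis mem_sphere_0)
  have "w \<noteq> 0" using w(1) by auto
  then have pos: "0 < N w" using N unfolding is_norm_def by (metis less_le)
  have "norm x \<le> 1 / N w" if x: "N x \<le> 1" for x
  proof (cases "x = 0")
    case False
    then have "N w \<le> N ((1 / norm x) *\<^sub>R x)" by (intro w(2)) simp
    also have "\<dots> = N x / norm x" using N False by (simp add: is_norm_def)
    finally have "N w * norm x \<le> N x" using False by (simp add: field_simps)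
    then show ?thesis using x pos by (simp add: field_simps)
  qed (use pos in simp)
  then show ?thesis unfolding bounded_iff unit_ball_def by blast
qed

lemma norm_le_diam:
  assumes N: "is_norm N" and A: "bounded A" "x \<in> A" "y \<in> A"
  shows "N (x - y) \<le> diam N A"
proof -
  have "bounded ((\<lambda>(x, y). x - y) ` (A \<times> A))"
    using bounded_minus[OF A(1) A(1)] by (rule bounded_subset) auto
  then have "compact (closure ((\<lambda>(x, y). x - y) ` (A \<times> A)))"
    by (simp add: compact_closure)
  then have "bounded (N ` closure ((\<lambda>(x, y). x - y) ` (A \<times> A)))"
    by (intro compact_imp_bounded compact_continuous_image is_norm_continuous_on[OF N])
  then have "bdd_above (N ` ((\<lambda>(x, y). x - y) ` (A \<times> A)))"
    by (meson bdd_above_mono bounded_imp_bdd_above closure_subset image_mono)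
  then have "bdd_above ((\<lambda>(x, y). N (x - y)) ` (A \<times> A))"
    by (simp add: image_image case_prod_unfold)
  then have "(\<lambda>(x, y). N (x - y)) (x, y) \<le> (SUP (x, y) \<in> A \<times> A. N (x - y))"
    using A by (intro cSUP_upper) auto
  then show ?thesis using A by (auto simp: diam_def)
qed

lemma diam_le:
  assumes "0 \<le> d" "\<And>x y. x \<in> A \<Longrightarrow> y \<in> A \<Longrightarrow> N (x - y) \<le> d"
  shows "diam N A \<le> d"
  unfolding diam_def using assms by (auto intro!: cSUP_least)

lemma diam_nonneg:
  assumes "is_norm N" "bounded A"
  shows "0 \<le> diam N A"
proof (cases "A = {}")
  case False
  then obtain x where "x \<in> A" by blast
  then have "N (x - x) \<le> diam N A" using norm_le_diam[OF assms] by blast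
  moreover have "0 \<le> N (x - x)" using assms unfolding is_norm_def by blast
  ultimately show ?thesis by linarith
qed (simp add: diam_def)

lemma diam_mono:
  assumes "is_norm N" "bounded B" "A \<subseteq> B"
  shows "diam N A \<le> diam N B"
  using assms by (intro diam_le norm_le_diam diam_nonneg) auto

lemma diam_pos:
  assumes "is_norm N" "bounded A" "x \<in> A" "y \<in> A" "x \<noteq> y"
  shows "0 < diam N A"
proof -
  have "0 < N (x - y)" using assms unfolding is_norm_def by (metis eq_iff_diff_eq_0 less_le)
  then show ?thesis using norm_le_diam[OF assms(1-4)] by linarith
qed

text \<open>
  A set of diameter \<open>\<delta>\<close> lies in the closed ball of radius \<open>\<delta>\<close> around each of its points, and balls
  are closed and convex. Absorbing the hull into such balls in both arguments in turn
  gives the bound.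
\<close>

lemma diam_closure_convex_hull:
  assumes N: "is_norm N" and A: "bounded A"
  shows "diam N (closure (convex hull A)) = diam N A"
proof (rule antisym)
  have absorb: "closure (convex hull A) \<subseteq> {y. N (x - y) \<le> diam N A}"
    if "A \<subseteq> {y. N (x - y) \<le> diam N A}" for x
    using that by (intro closure_minimal hull_minimal convex_norm_ball closed_norm_ball N)
  show "diam N (closure (convex hull A)) \<le> diam N A"
  proof (rule diam_le)
    fix x y assume x: "x \<in> closure (convex hull A)" and y: "y \<in> closure (convex hull A)"
    \<comment> \<open>The first absorption, around points of \<open>A\<close>, prepares the second one, around \<open>x\<close>.\<close>
    have "N (a - x) \<le> diam N A" if a: "a \<in> A" for a
      using absorb[of a] norm_le_diam[OF N A a] x by auto
    then have "A \<subseteq> {y. N (x - y) \<le> diam N A}"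
      using norm_commute[OF N] by auto
    then show "N (x - y) \<le> diam N A" using absorb y by blast
  qed (rule diam_nonneg[OF N A])
  show "diam N A \<le> diam N (closure (convex hull A))"
    using A hull_subset[of A convex] closure_subset[of "convex hull A"]
    by (intro diam_mono[OF N]) (auto simp: bounded_convex_hull)
qed

lemma bounded_dilation:
  fixes T :: "'a::real_normed_vector set"
  assumes "bounded T"
  shows "bounded ((\<lambda>x. g + r *\<^sub>R x) ` T)"
  using bounded_translation[OF bounded_scaling[OF assms], of g r] by (simp add: image_image)

lemma diam_dilation_le:
  assumes N: "is_norm N" and T: "bounded T" and r: "0 \<le> r"
  shows "diam N ((\<lambda>x. g + r *\<^sub>R x) ` T) \<le> r * diam N T"
proof (rule diam_le)
  fix x y assume "x \<in> (\<lambda>x. g + r *\<^sub>R x) ` T" "y \<in> (\<lambda>x. g + r *\<^sub>R x) ` T"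
  then obtain x' y' where xy: "x' \<in> T" "y' \<in> T" "x = g + r *\<^sub>R x'" "y = g + r *\<^sub>R y'"
    by blast
  then have "x - y = r *\<^sub>R (x' - y')" by (simp add: algebra_simps)
  then have "N (x - y) = r * N (x' - y')" using N r by (simp add: is_norm_def)
  then show "N (x - y) \<le> r * diam N T"
    using norm_le_diam[OF N T xy(1,2)] r by (simp add: mult_left_mono)
qed (use diam_nonneg[OF N T] r in simp)

lemma cover_value_nonneg:
  fixes P :: "nat \<Rightarrow> (real ^ 'n) set"
  assumes N: "is_norm N" and m: "1 \<le> m" and A: "bounded A" "A = (\<Union>k\<in>{1..m}. P k)"
  shows "0 \<le> (1 / diam N A) * Max ((\<lambda>k. diam N (P k)) ` {1..m})"
proof -
  have "(1::nat) \<in> {1..m}" using m by simp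
  then have "P 1 \<subseteq> A" unfolding A(2) by blast
  then have "bounded (P 1)" using A(1) bounded_subset by blast
  then have "0 \<le> diam N (P 1)" by (rule diam_nonneg[OF N])
  also have "\<dots> \<le> Max ((\<lambda>k. diam N (P k)) ` {1..m})" using m by (intro Max_ge) auto
  finally show ?thesis using diam_nonneg[OF N A(1)] by simp
qed

lemma beta_set_le:
  assumes N: "is_norm N" and m: "1 \<le> m" and A: "bounded A" "A = (\<Union>k\<in>{1..m}. P k)"
  shows "beta_set N A m \<le> (1 / diam N A) * Max ((\<lambda>k. diam N (P k)) ` {1..m})"
  unfolding beta_set_def
proof (rule cInf_lower)
  show "bdd_below {(1 / diam N A) * Max ((\<lambda>k. diam N (P k)) ` {1..m}) | P.
      A = (\<Union>k\<in>{1..m}. P k)}"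
    using cover_value_nonneg[OF N m A(1)] by (intro bdd_belowI[of _ 0]) blast
qed (use A(2) in blast)

lemma beta_set_greatest:
  assumes m: "1 \<le> m"
    and "\<And>P. A = (\<Union>k\<in>{1..m}. P k) \<Longrightarrow> b \<le> (1 / diam N A) * Max ((\<lambda>k. diam N (P k)) ` {1..m})"
  shows "b \<le> beta_set N A m"
proof -
  have "A = (\<Union>k\<in>{1..m}. (\<lambda>_. A) k)" using m by auto
  then show ?thesis unfolding beta_set_def using assms(2) by (intro cInf_greatest) blast+
qed

text \<open>
  A partition of \<open>T\<close>, dilated and intersected with \<open>A\<close>, is a partition of \<open>A\<close>. The factor
  \<open>r diam N T / diam N A\<close> accounts for the two normalisations.
\<close>

lemma beta_set_le_of_subset_dilation:
  assumes N: "is_norm N" and m: "1 \<le> m"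
    and A: "bounded A" "0 < diam N A" and T: "bounded T" "0 < diam N T"
    and r: "0 < r" and sub: "A \<subseteq> (\<lambda>x. g + r *\<^sub>R x) ` T"
  shows "beta_set N A m \<le> r * diam N T / diam N A * beta_set N T m"
proof -
  define q where "q = r * diam N T / diam N A"
  have q: "0 < q" using A T r by (simp add: q_def)
  have "beta_set N A m / q \<le> beta_set N T m"
  proof (rule beta_set_greatest[OF m])
    fix P :: "nat \<Rightarrow> (real ^ 'a) set" assume P: "T = (\<Union>k\<in>{1..m}. P k)"
    define Q where "Q k = A \<inter> (\<lambda>x. g + r *\<^sub>R x) ` P k" for k
    have "A = (\<Union>k\<in>{1..m}. Q k)" using sub unfolding P Q_def by blast
    then have "beta_set N A m \<le> (1 / diam N A) * Max ((\<lambda>k. diam N (Q k)) ` {1..m})"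
      by (rule beta_set_le[OF N m A(1)])
    moreover have "Max ((\<lambda>k. diam N (Q k)) ` {1..m}) \<le> r * Max ((\<lambda>k. diam N (P k)) ` {1..m})"
    proof -
      have "diam N (Q k) \<le> r * Max ((\<lambda>k. diam N (P k)) ` {1..m})" if k: "k \<in> {1..m}" for k
      proof -
        have "P k \<subseteq> T" using P k by blast
        then have Pk: "bounded (P k)" using T(1) bounded_subset by blast
        have "diam N (Q k) \<le> diam N ((\<lambda>x. g + r *\<^sub>R x) ` P k)"
          unfolding Q_def by (intro diam_mono[OF N] bounded_dilation Pk) blast
        also have "\<dots> \<le> r * diam N (P k)" using diam_dilation_le[OF N Pk] r by simp
        also have "\<dots> \<le> r * Max ((\<lambda>k. diam N (P k)) ` {1..m})"
          using k r by (intro mult_left_mono Max_ge) auto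
        finally show ?thesis .
      qed
      then show ?thesis using m by (subst Max_le_iff) auto
    qed
    ultimately have "beta_set N A m \<le> (1 / diam N A) * (r * Max ((\<lambda>k. diam N (P k)) ` {1..m}))"
      using mult_left_mono[of "Max ((\<lambda>k. diam N (Q k)) ` {1..m})"
          "r * Max ((\<lambda>k. diam N (P k)) ` {1..m})" "1 / diam N A"] A(2)
      by simp
    also have "\<dots> = q * ((1 / diam N T) * Max ((\<lambda>k. diam N (P k)) ` {1..m}))"
      using T(2) by (simp add: q_def)
    finally show "beta_set N A m / q \<le> (1 / diam N T) * Max ((\<lambda>k. diam N (P k)) ` {1..m})"
      using q by (simp add: field_simps)
  qed
  then show ?thesis using q unfolding q_def[symmetric] by (simp add: field_simps)
qed

lemma beta_set_nonneg:
  assumes N: "is_norm N" and m: "1 \<le> m" and A: "bounded A"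
  shows "0 \<le> beta_set N A m"
  by (rule beta_set_greatest[OF m cover_value_nonneg[OF N m A]])

lemma beta_set_le_1:
  assumes N: "is_norm N" and m: "1 \<le> m" and A: "bounded A"
  shows "beta_set N A m \<le> 1"
proof -
  have "beta_set N A m \<le> (1 / diam N A) * Max ((\<lambda>k. diam N A) ` {1..m})"
    using m by (intro beta_set_le[OF N m A]) auto
  also have "\<dots> \<le> 1" using m by simp
  finally show ?thesis .
qed

section \<open>The bound for the partition constants\<close>

text \<open>
  For the partner \<open>k\<close> of \<open>x\<close> one has \<open>(s + 1) (x - c) = s (x - k)\<close>, and \<open>x - k\<close> has norm at most
  the diameter.
\<close>

lemma reflection_centre_imp_subset_ball:
  assumes N: "is_norm N" and K: "bounded K" and s: "0 < s" "0 < diam N K"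
    and c: "\<And>x. x \<in> K \<Longrightarrow> c \<in> reflection_centres s K x"
  shows "K \<subseteq> (\<lambda>x. c + (s / (s + 1) * diam N K) *\<^sub>R x) ` unit_ball N"
proof
  fix x assume x: "x \<in> K"
  define r where "r = s / (s + 1) * diam N K"
  have r: "0 < r" using s by (simp add: r_def)
  obtain k where k: "k \<in> K" "(s + 1) *\<^sub>R c = s *\<^sub>R k + x"
    using c[OF x] unfolding reflection_centres_def by blast
  then have "(s + 1) *\<^sub>R (x - c) = s *\<^sub>R (x - k)"
    by (simp add: algebra_simps)
  then have "N ((s + 1) *\<^sub>R (x - c)) = N (s *\<^sub>R (x - k))" by simp
  then have "(s + 1) * N (x - c) = s * N (x - k)"
    using N s by (simp add: is_norm_def)
  also have "\<dots> \<le> s * diam N K" using norm_le_diam[OF N K x k(1)] s by simp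
  finally have "N (x - c) \<le> r" using s by (simp add: r_def field_simps)
  moreover have "N ((1 / r) *\<^sub>R (x - c)) = \<bar>1 / r\<bar> * N (x - c)"
    using N unfolding is_norm_def by blast
  ultimately have "(1 / r) *\<^sub>R (x - c) \<in> unit_ball N"
    using r by (simp add: unit_ball_def)
  moreover have "x = c + r *\<^sub>R ((1 / r) *\<^sub>R (x - c))" using r by simp
  ultimately show "x \<in> (\<lambda>x. c + (s / (s + 1) * diam N K) *\<^sub>R x) ` unit_ball N"
    unfolding r_def by blast
qed

lemma diam_unit_ball:
  fixes N :: "real ^ 'n \<Rightarrow> real"
  assumes N: "is_norm N"
  shows "0 < diam N (unit_ball N)" "diam N (unit_ball N) \<le> 2"
proof -
  obtain e :: "real ^ 'n" where "e \<noteq> 0" using zero_neq_one by blast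
  then have "0 < N e" using N unfolding is_norm_def by (metis less_le)
  then have "(1 / N e) *\<^sub>R e \<in> unit_ball N" "(1 / N e) *\<^sub>R e \<noteq> 0"
    using N \<open>e \<noteq> 0\<close> by (auto simp: unit_ball_def is_norm_def)
  moreover have "N 0 = 0" using N unfolding is_norm_def by blast
  then have "0 \<in> unit_ball N" by (simp add: unit_ball_def)
  ultimately show "0 < diam N (unit_ball N)"
    using diam_pos[OF N bounded_unit_ball[OF N]] by blast
  show "diam N (unit_ball N) \<le> 2"
  proof (rule diam_le)
    fix x y assume "x \<in> unit_ball N" "y \<in> unit_ball N"
    moreover have "N (x - y) \<le> N x + N (- y)"
      using N unfolding is_norm_def by (metis diff_conv_add_uminus)
    moreover have "N (- y) = N y" using norm_commute[OF N, of 0 y] by simp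
    ultimately show "N (x - y) \<le> 2" by (simp add: unit_ball_def)
  qed simp
qed

text \<open>
  The simplex obtained from \<open>symmetric_or_close_to_simplex\<close> has its vertices in \<open>K\<close>, hence its
  diameter is at most that of \<open>A\<close> and only the dilation factor enters the bound.
\<close>

theorem beta_set_le_max_simplex_ball:
  fixes N :: "real ^ 'n \<Rightarrow> real" and n m :: nat
  assumes N: "is_norm N" and m: "1 \<le> m" and n: "CARD('n) = n"
    and A: "bounded A" "0 < diam N A"
    and \<epsilon>: "0 < \<epsilon>" "\<epsilon> < 1 / real n"
  shows "beta_set N A m \<le>
    max ((1 + (real n + 1) * \<epsilon> / (1 - real n * \<epsilon>)) * (SUP T \<in> {T. int n simplex T}. beta_set N T m))
      (2 * (real n - \<epsilon>) / (real n + 1 - \<epsilon>) * beta_set N (unit_ball N) m)"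
proof -
  define K where "K = closure (convex hull A)"
  define s where "s = real n - \<epsilon>"
  define r where "r = 1 + (real n + 1) * \<epsilon> / (1 - real n * \<epsilon>)"
  have n1: "1 \<le> real n" using n by (metis One_nat_def Suc_leI of_nat_1 of_nat_le_iff zero_less_card_finite)
  have "1 / real n \<le> 1" using n1 by simp
  then have s: "0 < s" using \<epsilon> n1 unfolding s_def by linarith
  have "0 < 1 - real n * \<epsilon>" using \<epsilon> n1 by (simp add: field_simps)
  then have r: "0 < r" unfolding r_def using \<epsilon> by (intro add_pos_nonneg) auto
  have K: "compact K" "convex K" "A \<subseteq> K" "bounded K"
    unfolding K_def using A(1) hull_subset[of A convex] closure_subset[of "convex hull A"]
    by (auto simp: compact_closure bounded_convex_hull convex_closure)
  have diam_K: "diam N K = diam N A"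
    unfolding K_def by (rule diam_closure_convex_hull[OF N A(1)])
  \<comment> \<open>A finite convex set has at most one point, which positive diameter excludes.\<close>
  have "infinite K"
  proof
    assume "finite K"
    then obtain a where a: "K \<subseteq> {a}"
      using connected_finite_iff_sing convex_connected K(2) by blast
    have "N 0 = 0" using N unfolding is_norm_def by blast
    moreover have "x = y" if "x \<in> K" "y \<in> K" for x y using a that by blast
    ultimately have "diam N K \<le> 0" by (intro diam_le) fastforce+
    then show False using diam_K A(2) by simp
  qed
  moreover have "DIM(real ^ 'n) = n" using n by simp
  ultimately consider
      (symmetric) c where "\<And>x. x \<in> K \<Longrightarrow> c \<in> reflection_centres s K x"
    | (simplex) S g where "int n simplex convex hull S" "S \<subseteq> K"
        "K \<subseteq> (\<lambda>x. g + r *\<^sub>R x) ` (convex hull S)"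
    using symmetric_or_close_to_simplex[OF _ K(1,2) _ \<epsilon>] unfolding r_def s_def by blast
  then show ?thesis
  proof cases
    case (symmetric c)
    define B where "B = unit_ball N"
    have B: "bounded B" "0 < diam N B" "diam N B \<le> 2"
      using bounded_unit_ball[OF N] diam_unit_ball[OF N] unfolding B_def by auto
    have "A \<subseteq> (\<lambda>x. c + (s / (s + 1) * diam N A) *\<^sub>R x) ` B"
      using reflection_centre_imp_subset_ball[OF N K(4) s _ symmetric] K(3) A(2)
      unfolding diam_K B_def by auto
    then have "beta_set N A m
        \<le> (s / (s + 1) * diam N A) * diam N B / diam N A * beta_set N B m"
      using A s B by (intro beta_set_le_of_subset_dilation[OF N m]) auto
    also have "\<dots> = s / (s + 1) * diam N B * beta_set N B m" using A by simp
    also have "\<dots> \<le> s / (s + 1) * 2 * beta_set N B m"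
      using B s beta_set_nonneg[OF N m B(1)] by (intro mult_right_mono mult_left_mono) auto
    also have "s / (s + 1) * 2 = 2 * (real n - \<epsilon>) / (real n + 1 - \<epsilon>)"
      by (simp add: s_def algebra_simps)
    finally show ?thesis unfolding B_def by simp
  next
    case (simplex S g)
    define T where "T = convex hull S"
    have bounded_simplex: "bounded T" if "int n simplex T" for T :: "(real ^ 'n) set"
      using that unfolding simplex_def
      using aff_independent_finite bounded_convex_hull finite_imp_bounded by blast
    have T: "bounded T" using bounded_simplex simplex(1) unfolding T_def by blast
    have sub: "A \<subseteq> (\<lambda>x. g + r *\<^sub>R x) ` T" using simplex(3) K(3) unfolding T_def by blast
    then have "diam N A \<le> r * diam N T"
      using diam_mono[OF N bounded_dilation[OF T] sub] diam_dilation_le[OF N T, of r g] r by simp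
    then have diam_T: "0 < diam N T" using A(2) r by (smt (verit) mult_nonneg_nonpos)
    have "T \<subseteq> K" unfolding T_def using simplex(2) K(2) by (simp add: hull_minimal)
    then have "diam N T \<le> diam N A" using diam_mono[OF N K(4)] diam_K by metis
    then have "diam N T / diam N A \<le> 1" using A(2) by simp
    have "beta_set N A m \<le> r * diam N T / diam N A * beta_set N T m"
      by (rule beta_set_le_of_subset_dilation[OF N m A T diam_T r sub])
    also have "\<dots> = r * beta_set N T m * (diam N T / diam N A)" by simp
    also have "\<dots> \<le> r * beta_set N T m"
      using r beta_set_nonneg[OF N m T] \<open>diam N T / diam N A \<le> 1\<close>
      by (intro mult_left_le) auto
    finally have scaled: "beta_set N A m \<le> r * beta_set N T m" .
    have "beta_set N T m \<le> (SUP T \<in> {T. int n simplex T}. beta_set N T m)"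
      using simplex(1) beta_set_le_1[OF N m bounded_simplex]
      by (intro cSUP_upper bdd_aboveI[of _ 1]) (auto simp: T_def)
    then have "r * beta_set N T m \<le> r * (SUP T \<in> {T. int n simplex T}. beta_set N T m)"
      using r by simp
    then show ?thesis using scaled unfolding r_def by linarith
  qed
qed

lemma bounded_sets_nonempty:
  fixes N :: "real ^ 'n \<Rightarrow> real"
  assumes N: "is_norm N"
  shows "bounded_sets N \<noteq> {}"
  using bounded_unit_ball[OF N] diam_unit_ball(1)[OF N] unfolding bounded_sets_def by blast

theorem theorem12:
  fixes N :: "real ^ 3 \<Rightarrow> real" and m :: nat and \<eta> :: real
  assumes "is_norm N"
    and "1 \<le> m"
    and "\<eta> = (SUP T \<in> {T. 3 simplex T}. beta_set N T m)"
  shows "beta N m \<le>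
    (INF \<epsilon> \<in> {0<..<1/3::real}.
       max ((1 + 4 * \<epsilon> / (1 - 3 * \<epsilon>)) * \<eta>)
           (2 * (3 - \<epsilon>) / (4 - \<epsilon>) * beta_set N (unit_ball N) m))"
proof (rule cINF_greatest)
  show "{0<..<1/3::real} \<noteq> {}" by simp
  fix \<epsilon> :: real assume \<epsilon>: "\<epsilon> \<in> {0<..<1/3}"
  show "beta N m \<le> max ((1 + 4 * \<epsilon> / (1 - 3 * \<epsilon>)) * \<eta>)
    (2 * (3 - \<epsilon>) / (4 - \<epsilon>) * beta_set N (unit_ball N) m)"
    unfolding beta_def
  proof (rule cSUP_least[OF bounded_sets_nonempty[OF assms(1)]])
    fix A assume "A \<in> bounded_sets N"
    then have "bounded A" "0 < diam N A" unfolding bounded_sets_def by auto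
    then show "beta_set N A m \<le> max ((1 + 4 * \<epsilon> / (1 - 3 * \<epsilon>)) * \<eta>)
      (2 * (3 - \<epsilon>) / (4 - \<epsilon>) * beta_set N (unit_ball N) m)"
      using beta_set_le_max_simplex_ball[OF assms(1,2), of 3 A \<epsilon>] \<epsilon> assms(3) by simp
  qed
qed

end
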